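(* Let $L\ge1$. Define the differential operator $\mathcal S^{-1}$ by $$(\mathcal S^{-1}f)(x_1,\dots,x_L)=(-1)^{\frac{L(L-1)}2}\,\phi_\delta(x_1,\dots,x_L)^{-1}\,K_L\,\Big(\prod_{i=1}^L\phi_\delta(x_i)\; f(x_1,\dots,x_L)\Big),\qquad K_L=\det\big[D_{x_i}^{2(L-j)}\big]_{i,j=1}^L .$$ Then for every partition $\lambda=(\lambda_1\ge\dots\ge\lambda_L\ge0)$, $$\mathcal S^{-1}\prod_{i=1}^Lq_\lambda(x_i)=\frac{\chi_\lambda(x_1,\dots,x_L)}{\chi_\lambda(1,\dots,1)} .$$
   Context: $D_x=x\,\partial/\partial x$. $\delta=(L,L-1,\dots,1)$ and $\mu=\lambda+\delta$, i.e. $\mu_i=\lambda_i+L-i+1$. For a strictly decreasing sequence $\mu$ of $L$ positive integers, $a_\mu(x_1,\dots,x_L)=\det[x_i^{\mu_j}-x_i^{-\mu_j}]_{i,j=1}^L$, and for $1\le k\le L+1$, $a^{(k)}_\mu(x_1,\dots,x_{k-1})$ is the determinant of the $L\times L$ matrix whose $(i,j)$ entry is $x_i^{\mu_j}-x_i^{-\mu_j}$ for $i<k$ and $\mu_j^{2(L-i)+1}$ for $i\ge k$ (so $a^{(L+1)}_\mu=a_\mu$). The symplectic character is $\chi_\lambda=a_{\lambda+\delta}/a_\delta$ (a Laurent polynomial). Set $\phi_\mu(x_1,\dots,x_k)=a^{(k+1)}_\mu(x_1,\dots,x_k)/a^{(1)}_\mu$, and $q_\lambda(z)=\chi_\lambda(z,1,\dots,1)/\chi_\lambda(1,\dots,1)$.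 The determinant $K_L$ is well defined since the $D_{x_i}$ commute. *)

theory Defs
  imports
    Complex_Main
    "HOL-Library.Poly_Mapping"
    "HOL-Analysis.Derivative"
    "HOL-Combinatorics.Permutations"
    "Jordan_Normal_Form.Determinant"
begin

text \<open>Laurent polynomials over \<open>\<complex>\<close> in variables \<open>x\<^sub>1, x\<^sub>2, \<dots>\<close>: an inner poly-mapping is an
  exponent vector with finitely many nonzero integer entries, the outer one assigns coefficients.
  Variables and the sequences \<open>\<lambda>\<close>, \<open>\<mu>\<close>, \<open>\<delta>\<close> are indexed from \<open>1\<close>, whereas the entries of
  \<^const>\<open>mat\<close> are indexed from \<open>0\<close>, hence the occurrences of \<^const>\<open>Suc\<close> below.\<close>

type_synonym laurent = "(nat \<Rightarrow>\<^sub>0 int) \<Rightarrow>\<^sub>0 complex"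

definition var_pow :: "nat \<Rightarrow> int \<Rightarrow> laurent" where
  "var_pow i n = Poly_Mapping.single (Poly_Mapping.single i n) 1"

text \<open>Meaningful at points whose relevant coordinates are nonzero.\<close>

definition laurent_eval :: "(nat \<Rightarrow> complex) \<Rightarrow> laurent \<Rightarrow> complex" where
  "laurent_eval x p =
     (\<Sum>m\<in>Poly_Mapping.keys p. Poly_Mapping.lookup p m *
        (\<Prod>i\<in>Poly_Mapping.keys m. x i powi Poly_Mapping.lookup m i))"

definition delta :: "nat \<Rightarrow> nat \<Rightarrow> nat" where
  "delta L i = L - i + 1"

definition is_partition :: "nat \<Rightarrow> (nat \<Rightarrow> nat) \<Rightarrow> bool" where
  "is_partition L lam \<longleftrightarrow> (\<forall>i j. 1 \<le> i \<and> i \<le> j \<and> j \<le> L \<longrightarrow> lam j \<le> lam i)"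

definition alt :: "nat \<Rightarrow> (nat \<Rightarrow> nat) \<Rightarrow> laurent" where
  "alt L mu = det (mat L L (\<lambda>(i, j).
     var_pow (Suc i) (int (mu (Suc j))) - var_pow (Suc i) (- int (mu (Suc j)))))"

text \<open>The determinant \<open>a\<^sup>(\<^sup>k\<^sup>)\<^sub>\<mu>\<close>; only the variables \<open>x\<^sub>1, \<dots>, x\<^sub>k\<^sub>-\<^sub>1\<close> occur.\<close>

definition alt_part :: "nat \<Rightarrow> nat \<Rightarrow> (nat \<Rightarrow> nat) \<Rightarrow> laurent" where
  "alt_part k L mu = det (mat L L (\<lambda>(i, j).
     if Suc i < k
     then var_pow (Suc i) (int (mu (Suc j))) - var_pow (Suc i) (- int (mu (Suc j)))
     else of_nat (mu (Suc j)) ^ (2 * (L - Suc i) + 1)))"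

text \<open>The quotient \<open>a\<^sub>\<lambda>\<^sub>+\<^sub>\<delta> / a\<^sub>\<delta>\<close> in the ring of Laurent polynomials, so that it can
  be evaluated at points where \<open>a\<^sub>\<delta>\<close> vanishes, such as \<open>(1, \<dots>, 1)\<close>.\<close>

definition symp_char :: "nat \<Rightarrow> (nat \<Rightarrow> nat) \<Rightarrow> laurent" where
  "symp_char L lam =
     (THE c. c * alt L (delta L) = alt L (\<lambda>i. lam i + delta L i))"

definition phi :: "nat \<Rightarrow> (nat \<Rightarrow> nat) \<Rightarrow> nat \<Rightarrow> (nat \<Rightarrow> complex) \<Rightarrow> complex" where
  "phi L mu k x =
     laurent_eval x (alt_part (k + 1) L mu) / laurent_eval x (alt_part 1 L mu)"

definition q :: "nat \<Rightarrow> (nat \<Rightarrow> nat) \<Rightarrow> complex \<Rightarrow> complex" where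
  "q L lam z =
     laurent_eval (\<lambda>i. if i = 1 then z else 1) (symp_char L lam) /
     laurent_eval (\<lambda>_. 1) (symp_char L lam)"

definition D :: "nat \<Rightarrow> ((nat \<Rightarrow> complex) \<Rightarrow> complex) \<Rightarrow> (nat \<Rightarrow> complex) \<Rightarrow> complex" where
  "D i f = (\<lambda>x. x i * deriv (\<lambda>t. f (x(i := t))) (x i))"

text \<open>The Leibniz expansion of \<open>det [D\<^sub>i\<^bsup>2(L-j)\<^esup>]\<close>, the product of operators being composition.\<close>

definition K :: "nat \<Rightarrow> ((nat \<Rightarrow> complex) \<Rightarrow> complex) \<Rightarrow> (nat \<Rightarrow> complex) \<Rightarrow> complex" where
  "K L f = (\<lambda>x. \<Sum>p | p permutes {1..L}.
     of_int (sign p) * foldr (\<lambda>i. D i ^^ (2 * (L - p i))) [1..<Suc L] f x)"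

definition S_inv :: "nat \<Rightarrow> ((nat \<Rightarrow> complex) \<Rightarrow> complex) \<Rightarrow> (nat \<Rightarrow> complex) \<Rightarrow> complex" where
  "S_inv L f = (\<lambda>x. (-1) ^ (L * (L - 1) div 2) * inverse (phi L (delta L) L x) *
     K L (\<lambda>y. (\<Prod>i=1..L. phi L (delta L) 1 (\<lambda>_. y i)) * f y) x)"

end

theory Submission imports Defs begin

text \<open>Since \<open>x\<^sup>m - x\<^sup>-\<^sup>m = (x - 1/x) U\<^sub>m(x + 1/x)\<close> for a polynomial \<open>U\<^sub>m\<close>, Newton interpolation
  at the nodes \<open>t\<^sub>i = x\<^sub>i + 1/x\<^sub>i\<close> writes \<open>a\<^sub>\<mu>\<close> as a factor independent of \<open>\<mu>\<close> times the determinant of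
  the divided differences \<open>U\<^sub>\<mu>\<^sub>j[t\<^sub>0, \<dots>, t\<^sub>k]\<close>. For \<open>\<mu> = \<delta>\<close> that matrix is antitriangular with
  determinant \<open>(-1)\<^bsup>L(L-1)/2\<^esup>\<close>, so \<open>\<chi>\<^sub>\<lambda>\<close> is, up to this sign, the determinant for \<open>\<mu> = \<lambda> + \<delta>\<close>. This formula
  survives the collision of nodes: at \<open>(z, 1, \<dots>, 1)\<close> the functions \<open>m \<mapsto> z\<^sup>m - z\<^sup>-\<^sup>m\<close> and
  \<open>m \<mapsto> m\<^bsup>2r+1\<^esup>\<close> are combinations of the confluent divided differences, whence
  \<open>q\<^sub>\<lambda>(z) \<phi>\<^sub>\<delta>(z) = \<phi>\<^sub>\<mu>(z)\<close>.

  Expanding \<open>\<phi>\<^sub>\<mu>(z) = \<Sum>\<^sub>j c\<^sub>j (z\<^bsup>\<mu>\<^sub>j\<^esup> - z\<^bsup>-\<mu>\<^sub>j\<^esup>)\<close>, the operator \<open>K\<^sub>L\<close> turns \<open>\<Prod>\<^sub>i \<phi>\<^sub>\<mu>(x\<^sub>i)\<close> into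
  \<open>a\<^sub>\<mu>(x) det[c\<^sub>k \<mu>\<^sub>k\<^bsup>2(L-j)\<^esup>]\<close>. With \<open>M\<^sub>i\<^sub>j = \<mu>\<^sub>j\<^bsup>2(L-i)+1\<^esup>\<close> the vector \<open>c\<close> is the first column of
  \<open>M\<^sup>-\<^sup>1\<close>, so \<open>M\<close> times the matrix \<open>[c\<^sub>k \<mu>\<^sub>k\<^bsup>2(L-j)\<^esup>]\<close> is again antitriangular, and the two signs cancel.\<close>

section \<open>Divided differences\<close>

text \<open>\<open>newton t k m\<close> is the divided difference \<open>U\<^sub>m[t\<^sub>0, \<dots>, t\<^sub>k]\<close>. The recursion comes from
  \<open>U\<^sub>m\<^sub>+\<^sub>2(s) = s U\<^sub>m\<^sub>+\<^sub>1(s) - U\<^sub>m(s)\<close> by the Leibniz rule for divided differences; it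
  involves no division and allows coinciding nodes.\<close>

fun newton :: "(nat \<Rightarrow> 'a::comm_ring_1) \<Rightarrow> nat \<Rightarrow> nat \<Rightarrow> 'a" where
  "newton t k 0 = 0"
| "newton t k (Suc 0) = (if k = 0 then 1 else 0)"
| "newton t k (Suc (Suc m)) = t k * newton t k (Suc m) - newton t k m
     + (if k = 0 then 0 else newton t (k - 1) (Suc m))"

text \<open>Newton's interpolation formula for U_m at the node \<open>t i\<close>; terms with
  \<open>k > i\<close> drop out because their product contains \<open>t i - t i\<close>. In the
  induction, shifting the index in the last term of the recursion turns the multiplier
  \<open>t k\<close> into \<open>t i\<close>.\<close>

lemma newton_expand:
  "newton (\<lambda>_. t i) 0 m = (\<Sum>k\<le>i. (\<Prod>l<k. t i - t l) * newton t k m)"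
proof (induction m rule: induct_nat_012)
  case 0
  then show ?case by simp
next
  case 1
  show ?case by (simp add: sum.delta if_distrib cong: if_cong)
next
  case (ge2 m)
  define N where "N k = (\<Prod>l<k. t i - t l)" for k
  have "(\<Sum>k\<le>i. N k * (if k = 0 then 0 else newton t (k - 1) (Suc m)))
      = (\<Sum>k<i. N (Suc k) * newton t k (Suc m))"
    by (cases i) (simp_all add: sum.atMost_Suc_shift lessThan_Suc_atMost del: sum.atMost_Suc)
  also have "\<dots> = (\<Sum>k<i. N k * (t i - t k) * newton t k (Suc m))"
    by (simp add: N_def)
  also have "\<dots> = (\<Sum>k\<le>i. N k * (t i - t k) * newton t k (Suc m))"
    by (simp add: lessThan_Suc_atMost[symmetric])
  finally have "(\<Sum>k\<le>i. N k * newton t k (Suc (Suc m)))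
      = (\<Sum>k\<le>i. N k * (t k * newton t k (Suc m)) - N k * newton t k m + N k * (t i - t k) * newton t k (Suc m))"
    by (simp add: sum.distrib sum_subtractf algebra_simps del: if_distrib)
  also have "\<dots> = t i * (\<Sum>k\<le>i. N k * newton t k (Suc m)) - (\<Sum>k\<le>i. N k * newton t k m)"
    by (simp add: sum_distrib_left sum_subtractf[symmetric] algebra_simps)
  finally show ?case using ge2 by (simp add: N_def)
qed

lemma newton_node: "newton t 0 m = newton (\<lambda>_. t 0) 0 m"
  using newton_expand[of t 0 m] by simp

text \<open>U_m is zero or monic of degree m - 1. This gives the vanishing here and the value 1 at
  top order in the next lemma.\<close>

lemma newton_eq_0: "m \<le> k \<Longrightarrow> newton t k m = 0"
  by (induction t k m rule: newton.induct) auto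

lemma newton_Suc_self: "newton t k (Suc k) = 1"
  by (induction k) (simp_all add: newton_eq_0)

text \<open>Both sides satisfy f(m+2) = (x+y) f(m+1) - f(m). Taking \<open>y\<close> with
  \<open>x * y = 1\<close> instead of an inverse covers Laurent polynomials as well as complex
  numbers.\<close>

lemma power_diff_eq_newton:
  fixes x y :: "'a::comm_ring_1"
  assumes "x * y = 1"
  shows "x ^ m - y ^ m = (x - y) * newton (\<lambda>_. x + y) 0 m"
proof (induction m rule: induct_nat_012)
  case (ge2 n)
  have "x ^ Suc (Suc n) - y ^ Suc (Suc n)
      = (x + y) * (x ^ Suc n - y ^ Suc n) - x * y * (x ^ n - y ^ n)"
    by (simp add: algebra_simps)
  then show ?case using assms ge2 by (simp only: newton.simps) (simp add: algebra_simps)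
qed auto

lemma (in comm_ring_hom) hom_newton: "hom (newton t k m) = newton (\<lambda>i. hom (t i)) k m"
  by (induction t k m rule: newton.induct) (auto simp: hom_distribs)

section \<open>Determinant factorisations and antitriangular matrices\<close>

lemma det_mat_mult:
  fixes a b :: "nat \<Rightarrow> nat \<Rightarrow> 'a::comm_ring_1"
  shows "det (mat n n (\<lambda>(i,j). \<Sum>k<n. a i k * b k j))
    = det (mat n n (\<lambda>(i,j). a i j)) * det (mat n n (\<lambda>(i,j). b i j))"
proof -
  have "mat n n (\<lambda>(i,j). \<Sum>k<n. a i k * b k j) = mat n n (\<lambda>(i,j). a i j) * mat n n (\<lambda>(i,j). b i j)"
    by (auto intro!: eq_matI simp: scalar_prod_def lessThan_atLeast0)
  then show ?thesis by (simp add: det_mult[of _ n])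
qed

text \<open>The only nonzero entry of the last column is in row 0; expanding along that column gives
  the sign (-1)^n and a smaller matrix of the same shape.\<close>

lemma det_antitriangular:
  fixes f :: "nat \<Rightarrow> nat \<Rightarrow> 'a::comm_ring_1"
  assumes "\<And>i j. i < n \<Longrightarrow> j < n \<Longrightarrow> n \<le> i + j \<Longrightarrow> f i j = 0"
    and "\<And>i j. i + j + 1 = n \<Longrightarrow> f i j = 1"
  shows "det (mat n n (\<lambda>(i,j). f i j)) = (-1) ^ (n * (n - 1) div 2)"
  using assms
proof (induction n arbitrary: f)
  case 0
  then show ?case by simp
next
  case (Suc n)
  let ?A = "mat (Suc n) (Suc n) (\<lambda>(i,j). f i j)"
  have "det ?A = (\<Sum>i<Suc n. ?A $$ (i,n) * cofactor ?A i n)"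
    by (rule laplace_expansion_column) auto
  also have "\<dots> = (\<Sum>i<Suc n. if i = 0 then cofactor ?A 0 n else 0)"
    by (intro sum.cong) (auto simp: Suc.prems)
  also have "\<dots> = cofactor ?A 0 n" by (subst sum.delta) auto
  also have "mat_delete ?A 0 n = mat n n (\<lambda>(i,j). f (Suc i) j)"
    by (auto intro!: eq_matI simp: mat_delete_def)
  then have "cofactor ?A 0 n = (-1) ^ n * det (mat n n (\<lambda>(i,j). f (Suc i) j))"
    by (simp add: cofactor_def)
  also have "det (mat n n (\<lambda>(i,j). f (Suc i) j)) = (-1) ^ (n * (n - 1) div 2)"
    by (rule Suc.IH) (auto intro: Suc.prems)
  also have "(-1) ^ n * (-1) ^ (n * (n - 1) div 2) = (-1 :: 'a) ^ (Suc n * (Suc n - 1) div 2)"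
  proof -
    have "Suc n * (Suc n - 1) = n * (n - 1) + n * 2" by (cases n) auto
    then have "n + n * (n - 1) div 2 = Suc n * (Suc n - 1) div 2" by simp
    then show ?thesis by (simp only: power_add[symmetric])
  qed
  finally show ?case .
qed

lemma det_mult_row:
  fixes f :: "nat \<Rightarrow> nat \<Rightarrow> 'a::comm_ring_1"
  shows "det (mat n n (\<lambda>(i,j). c i * f i j)) = (\<Prod>i<n. c i) * det (mat n n (\<lambda>(i,j). f i j))"
  by (simp add: det_def prod.distrib lessThan_atLeast0 sum_distrib_left algebra_simps)

text \<open>A row scaling, a lower triangular matrix of Newton products and the matrix of divided
  differences. The triangular determinant stays unevaluated, as only its independence of
  \<open>mu\<close> matters later.\<close>

lemma det_power_diff:
  fixes x y :: "nat \<Rightarrow> 'a::comm_ring_1"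
  assumes "\<And>i. i < n \<Longrightarrow> x i * y i = 1"
  shows "det (mat n n (\<lambda>(i,j). x i ^ mu j - y i ^ mu j))
    = (\<Prod>i<n. x i - y i) * det (mat n n (\<lambda>(i,j). if j \<le> i then \<Prod>l<j. (x i + y i) - (x l + y l) else 0))
      * det (mat n n (\<lambda>(i,j). newton (\<lambda>i. x i + y i) i (mu j)))"
proof -
  define t where "t i = x i + y i" for i
  have "x i ^ mu j - y i ^ mu j
      = (x i - y i) * (\<Sum>k<n. (if k \<le> i then \<Prod>l<k. t i - t l else 0) * newton t k (mu j))"
    if "i < n" for i j
  proof -
    have "{..i} = {k \<in> {..<n}. k \<le> i}" using that by auto
    then show ?thesis
      using power_diff_eq_newton[OF assms[OF that], of "mu j"] newton_expand[of t i "mu j"]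
      by (simp add: t_def sum.inter_filter[symmetric] if_distribR if_distrib[of "\<lambda>c. c * _"] cong: if_cong)
  qed
  then have "mat n n (\<lambda>(i,j). x i ^ mu j - y i ^ mu j)
     = mat n n (\<lambda>(i,j). (x i - y i) * (\<Sum>k<n. (if k \<le> i then \<Prod>l<k. t i - t l else 0) * newton t k (mu j)))"
    by (intro cong_mat) auto
  then show ?thesis
    unfolding t_def by (simp only: det_mult_row det_mat_mult mult.assoc)
qed

lemma det_newton_delta:
  "det (mat n n (\<lambda>(i,j). newton t i (n - j))) = (-1) ^ (n * (n - 1) div 2)"
proof (rule det_antitriangular)
  show "newton t i (n - j) = 1" if "i + j + 1 = n" for i j
  proof -
    have "n - j = Suc i" using that by simp
    then show ?thesis by (simp add: newton_Suc_self)
  qed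
qed (auto intro: newton_eq_0)

section \<open>Coinciding nodes and odd powers\<close>

lemma newton_two: "newton (\<lambda>_. 2) k m = (of_nat ((m + k) choose (2 * k + 1)) :: 'a::comm_ring_1)"
proof (induction m arbitrary: k rule: induct_nat_012)
  case (ge2 m)
  show ?case
  proof (cases k)
    case 0
    then show ?thesis using ge2 by (simp add: algebra_simps)
  next
    case (Suc r)
    define N K where "N = m + k" and "K = 2 * r + 1"
    have "((N + 2) choose (K + 2)) + (N choose (K + 2)) = 2 * ((N + 1) choose (K + 2)) + (N choose K)"
      by simp
    then have "(of_nat ((N + 2) choose (K + 2)) :: 'a) + of_nat (N choose (K + 2))
       = 2 * of_nat ((N + 1) choose (K + 2)) + of_nat (N choose K)"
      by (metis of_nat_add of_nat_mult of_nat_numeral)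
    then show ?thesis using ge2 Suc
      by (simp add: N_def K_def algebra_simps del: binomial_Suc_Suc)
  qed
qed (auto simp: binomial_eq_0)

text \<open>Multiplication by m^2 raises the order by at most one, because (m^2 - (k+1)^2) C(m+k,
  2k+1) = (2k+2)(2k+3) C(m+k+1, 2k+3).\<close>

lemma newton_two_mult_square:
  "of_nat m ^ 2 * newton (\<lambda>_. 2) k m =
    of_nat ((k + 1) ^ 2) * newton (\<lambda>_. 2) k m
    + of_nat ((2 * k + 2) * (2 * k + 3)) * (newton (\<lambda>_. 2) (Suc k) m :: 'a::comm_ring_1)"
proof -
  define N K where "N = m + k" and "K = 2 * k + 1"
  have "int (m\<^sup>2 * (N choose K)) = int ((k + 1) ^ 2 * (N choose K) + (K + 1) * (K + 2) * (Suc N choose (K + 2)))"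
  \<comment> \<open>Here \<open>Suc N\<close> and \<open>N - K\<close> stand for m + k + 1 and m - k
    - 1, with product m^2 - (k+1)^2; the integers avoid truncated subtraction. For
    \<open>K > N\<close> both binomials are 0.\<close>
  proof (cases "K \<le> N")
    case True
    have 1: "(K + 2) * (Suc N choose (K + 2)) = Suc N * (N choose (K + 1))"
      using Suc_times_binomial[of "K + 1" N] by (simp del: binomial_Suc_Suc)
    have 2: "(K + 1) * (N choose (K + 1)) = (N - K) * (N choose K)"
      using binomial_absorb_comp[of N K] binomial_absorption[of K N]
      by (simp del: binomial_Suc_Suc mult_Suc)
    have "(K + 1) * (K + 2) * (Suc N choose (K + 2)) = Suc N * (N - K) * (N choose K)"
      by (metis 1 2 mult.assoc mult.left_commute)
    moreover have "int (Suc N) * (int N - int K) + int (k + 1) ^ 2 = int m ^ 2"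
      by (simp add: N_def K_def power2_eq_square algebra_simps)
    moreover from True have "int (N - K) = int N - int K" by simp
    ultimately show ?thesis
      by (simp only: of_nat_add of_nat_mult of_nat_power) (metis (no_types, lifting) add.commute distrib_right)
  next
    case False
    then show ?thesis by (auto simp: binomial_eq_0 not_le)
  qed
  then have "m\<^sup>2 * (N choose K) = (k + 1) ^ 2 * (N choose K) + (K + 1) * (K + 2) * (Suc N choose (K + 2))"
    by (simp only: of_nat_eq_iff)
  then have "(of_nat m)\<^sup>2 * (of_nat (N choose K) :: 'a) = of_nat ((k + 1) ^ 2) * of_nat (N choose K)
      + of_nat ((K + 1) * (K + 2)) * of_nat (Suc N choose (K + 2))"
    by (metis of_nat_add of_nat_mult of_nat_power)
  then show ?thesis
    by (simp only: newton_two N_def K_def) (simp add: algebra_simps del: binomial_Suc_Suc)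
qed

text \<open>Functions of the exponent \<open>m\<close>, because the rows of the determinants below
  are such functions evaluated at the entries of \<open>mu\<close>.\<close>

definition newton_span :: "(nat \<Rightarrow> 'a::comm_ring_1) \<Rightarrow> nat \<Rightarrow> (nat \<Rightarrow> 'a) set" where
  "newton_span t n = {f. \<exists>a. \<forall>m. f m = (\<Sum>k<n. a k * newton t k m)}"

lemma newton_span_newton:
  assumes "k < n"
  shows "newton t k \<in> newton_span t n"
proof -
  have "newton t k m = (\<Sum>l<n. (if l = k then 1 else 0) * newton t l m)" for m
    using assms by (simp add: if_distribR if_distrib[of "\<lambda>c. c * _"] sum.delta cong: if_cong)
  then show ?thesis unfolding newton_span_def by (intro CollectI exI allI)
qed

lemma newton_span_0: "(\<lambda>_. 0) \<in> newton_span t n"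
  unfolding newton_span_def by (intro CollectI exI[of _ "\<lambda>_. 0"]) simp

lemma newton_span_add:
  assumes "f \<in> newton_span t n" "g \<in> newton_span t n"
  shows "(\<lambda>m. f m + g m) \<in> newton_span t n"
proof -
  from assms obtain a b where "\<And>m. f m = (\<Sum>k<n. a k * newton t k m)"
      "\<And>m. g m = (\<Sum>k<n. b k * newton t k m)"
    unfolding newton_span_def by blast
  then have "\<forall>m. f m + g m = (\<Sum>k<n. (a k + b k) * newton t k m)"
    by (simp add: sum.distrib distrib_right)
  then show ?thesis unfolding newton_span_def by (intro CollectI exI)
qed

lemma newton_span_mult:
  assumes "f \<in> newton_span t n"
  shows "(\<lambda>m. c * f m) \<in> newton_span t n"
proof -
  from assms obtain a where "\<And>m. f m = (\<Sum>k<n. a k * newton t k m)"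
    unfolding newton_span_def by blast
  then have "\<forall>m. c * f m = (\<Sum>k<n. (c * a k) * newton t k m)"
    by (simp add: sum_distrib_left mult.assoc)
  then show ?thesis unfolding newton_span_def by (intro CollectI exI)
qed

text \<open>Used with \<open>h\<close> the square, to raise odd powers, and with
  \<open>h = 1\<close>, to change the nodes.\<close>

lemma newton_span_combine:
  assumes "f \<in> newton_span s k" "\<And>l. l < k \<Longrightarrow> (\<lambda>m. h m * newton s l m) \<in> newton_span t n"
  shows "(\<lambda>m. h m * f m) \<in> newton_span t n"
proof -
  from assms(1) obtain a where a: "\<And>m. f m = (\<Sum>l<k. a l * newton s l m)"
    unfolding newton_span_def by blast
  have "(\<lambda>m. \<Sum>l<j. a l * (h m * newton s l m)) \<in> newton_span t n" if "j \<le> k" for j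
    using that
    by (induction j) (auto intro!: newton_span_0 newton_span_add newton_span_mult assms(2))
  from this[of k] show ?thesis
    by (simp add: a sum_distrib_left mult.left_commute)
qed

text \<open>Each step multiplies by m^2 and so costs one order; therefore \<open>n\<close> varies in
  the induction.\<close>

lemma odd_power_newton_span:
  "r < n \<Longrightarrow> (\<lambda>m. (of_nat m :: 'a::comm_ring_1) ^ (2 * r + 1)) \<in> newton_span (\<lambda>_. 2) n"
proof (induction r arbitrary: n)
  case 0
  have "newton (\<lambda>_. 2) 0 = (of_nat :: nat \<Rightarrow> 'a)"
    by (simp add: newton_two fun_eq_iff)
  then show ?case using newton_span_newton[OF 0, of "\<lambda>_. 2 :: 'a"] by simp
next
  case (Suc r)
  obtain k where n: "n = Suc k" "r < k" using Suc.prems by (cases n) auto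
  have "(\<lambda>m. (of_nat m :: 'a) ^ 2 * of_nat m ^ (2 * r + 1)) \<in> newton_span (\<lambda>_. 2) n"
    by (rule newton_span_combine[OF Suc.IH[OF n(2)]], subst newton_two_mult_square)
      (auto intro!: newton_span_add newton_span_mult newton_span_newton simp: n(1) simp del: of_nat_mult)
  then show ?case by (simp add: power2_eq_square mult.assoc)
qed

text \<open>For all nodes equal to \<open>2\<close> the divided differences are the Taylor coefficients of \<open>U\<^sub>m\<close>
  at \<open>2\<close>; replacing the node \<open>t\<^sub>0\<close> by \<open>2\<close> is one application of the defining quotient.\<close>

lemma newton_two_shift:
  assumes "\<And>i. i \<ge> 1 \<Longrightarrow> t i = 2"
  shows "newton (\<lambda>_. 2) k m = newton t k m + (2 - t 0) * newton t (Suc k) m"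
proof (induction m arbitrary: k rule: induct_nat_012)
  case (ge2 m)
  show ?case
  proof (cases k)
    case 0
    then show ?thesis using assms[of 1] by (simp add: ge2 algebra_simps)
  next
    case (Suc r)
    then show ?thesis using assms[of k] assms[of "Suc k"] by (simp add: ge2 algebra_simps)
  qed
qed auto

text \<open>Freeing the first node costs one more order, hence \<open>Suc r < n\<close> in place of
  \<open>r < n\<close>.\<close>

lemma odd_power_newton_span_shift:
  fixes t :: "nat \<Rightarrow> 'a::comm_ring_1"
  assumes "\<And>i. i \<ge> 1 \<Longrightarrow> t i = 2" "Suc r < n"
  shows "(\<lambda>m. of_nat m ^ (2 * r + 1)) \<in> newton_span t n"
proof -
  have "(\<lambda>m. 1 * (of_nat m :: 'a) ^ (2 * r + 1)) \<in> newton_span t n"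
  proof (rule newton_span_combine[OF odd_power_newton_span[of r "n - 1"]])
    show "(\<lambda>m. 1 * newton (\<lambda>_. 2) l m) \<in> newton_span t n" if "l < n - 1" for l
      using that
      by (simp only: mult_1 newton_two_shift[of t, OF assms(1)])
        (intro newton_span_add newton_span_mult newton_span_newton; simp)
  qed (use assms in auto)
  then show ?thesis by simp
qed

lemma minus_one_power_square: "(-1) ^ n * ((-1) ^ n * x) = (x :: 'a::comm_ring_1)"
  unfolding mult.assoc[symmetric] by (simp flip: power_mult_distrib)

text \<open>The matrix of coefficients of the \<open>r i\<close> does not involve \<open>mu\<close>.
  The exponents \<open>n - j\<close> of \<open>delta\<close> determine its determinant, since the
  matrix of divided differences is then antitriangular.\<close>

lemma det_newton_span:
  assumes "\<And>i. i < n \<Longrightarrow> r i \<in> newton_span t n"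
  shows "det (mat n n (\<lambda>(i,j). r i (mu j))) = (-1) ^ (n * (n - 1) div 2) *
    det (mat n n (\<lambda>(i,j). newton t i (mu j))) * det (mat n n (\<lambda>(i,j). r i (n - j)))"
proof -
  have "\<forall>i. \<exists>a. i < n \<longrightarrow> (\<forall>m. r i m = (\<Sum>k<n. a k * newton t k m))"
    using assms unfolding newton_span_def by blast
  then obtain a where a: "\<And>i m. i < n \<Longrightarrow> r i m = (\<Sum>k<n. a i k * newton t k m)"
    by metis
  have *: "det (mat n n (\<lambda>(i,j). r i (nu j))) =
      det (mat n n (\<lambda>(i,j). a i j)) * det (mat n n (\<lambda>(i,j). newton t i (nu j)))" for nu
    unfolding det_mat_mult[symmetric]
    by (intro arg_cong[where f = det] cong_mat) (auto simp: a)
  show ?thesis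
    by (simp add: *[of mu] *[of "\<lambda>j. n - j"] det_newton_delta minus_one_power_square mult.left_commute mult.commute)
qed

section \<open>Laurent polynomials\<close>

definition monom_eval :: "(nat \<Rightarrow> complex) \<Rightarrow> (nat \<Rightarrow>\<^sub>0 int) \<Rightarrow> complex" where
  "monom_eval x m = (\<Prod>i\<in>Poly_Mapping.keys m. x i powi Poly_Mapping.lookup m i)"

lemma laurent_eval_superset:
  assumes "finite A" "Poly_Mapping.keys p \<subseteq> A"
  shows "laurent_eval x p = (\<Sum>m\<in>A. Poly_Mapping.lookup p m * monom_eval x m)"
  unfolding laurent_eval_def monom_eval_def
  by (rule sum.mono_neutral_left) (use assms in \<open>auto simp: in_keys_iff\<close>)

lemma laurent_eval_add: "laurent_eval x (p + r) = laurent_eval x p + laurent_eval x r"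
proof -
  let ?A = "Poly_Mapping.keys p \<union> Poly_Mapping.keys r"
  show ?thesis
    using keys_add[of p r]
    by (simp add: laurent_eval_superset[of ?A] lookup_add distrib_right sum.distrib)
qed

lemma laurent_eval_single: "laurent_eval x (Poly_Mapping.single m c) = c * monom_eval x m"
  by (subst laurent_eval_superset[of "{m}"]) auto

lemma monom_eval_superset:
  assumes "finite A" "Poly_Mapping.keys m \<subseteq> A"
  shows "monom_eval x m = (\<Prod>i\<in>A. x i powi Poly_Mapping.lookup m i)"
  unfolding monom_eval_def
  by (rule prod.mono_neutral_left) (use assms in \<open>auto simp: in_keys_iff\<close>)

lemma monom_eval_add:
  assumes "\<And>i. x i \<noteq> 0"
  shows "monom_eval x (m + n) = monom_eval x m * monom_eval x n"
proof -
  let ?A = "Poly_Mapping.keys m \<union> Poly_Mapping.keys n"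
  show ?thesis
    using keys_add[of m n] assms
    by (simp add: monom_eval_superset[of ?A] lookup_add power_int_add prod.distrib)
qed

lemma poly_mapping_add_induct:
  fixes p :: "'a \<Rightarrow>\<^sub>0 'b::monoid_add"
  assumes "P 0" "\<And>p m c. P p \<Longrightarrow> P (p + Poly_Mapping.single m c)"
  shows "P p"
proof (induction p rule: update_induct)
  case (update f a b)
  have "Poly_Mapping.update a b f = f + Poly_Mapping.single a b"
    using update(1)
    by (intro poly_mapping_eqI) (auto simp: lookup_update lookup_add lookup_single in_keys_iff when_def)
  then show ?case using assms(2) update by simp
qed fact

lemma comm_ring_hom_laurent_eval:
  assumes "\<And>i. x i \<noteq> 0"
  shows "comm_ring_hom (laurent_eval x)"
proof
  show "laurent_eval x (p + r) = laurent_eval x p + laurent_eval x r" for p r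
    by (rule laurent_eval_add)
  show "laurent_eval x 0 = 0" by (simp add: laurent_eval_def)
  show "laurent_eval x 1 = 1" by (simp add: laurent_eval_def)
  have single: "laurent_eval x (Poly_Mapping.single m c * r)
      = laurent_eval x (Poly_Mapping.single m c) * laurent_eval x r" for m c r
    by (induction r rule: poly_mapping_add_induct)
      (simp_all add: \<open>laurent_eval x 0 = 0\<close> laurent_eval_add distrib_left mult_single
        laurent_eval_single monom_eval_add[OF assms])
  show "laurent_eval x (p * r) = laurent_eval x p * laurent_eval x r" for p r
    by (induction p rule: poly_mapping_add_induct)
      (simp_all add: \<open>laurent_eval x 0 = 0\<close> laurent_eval_add distrib_right single)
qed

lemma laurent_eval_var_pow: "laurent_eval x (var_pow i n) = x i powi n"
  unfolding var_pow_def laurent_eval_single monom_eval_def by (cases "n = 0") auto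

lemma var_pow_add: "var_pow i (m + n) = var_pow i m * var_pow i n"
  by (simp add: var_pow_def mult_single single_add)

lemma var_pow_0: "var_pow i 0 = 1"
  by (simp add: var_pow_def)

lemma var_pow_mult: "var_pow i (n * int k) = var_pow i n ^ k"
  by (induction k) (simp_all add: var_pow_0 distrib_left var_pow_add)

text \<open>Evaluation is multiplicative only at points all of whose coordinates are nonzero, as
  \<open>0 powi n = 0\<close> for \<open>n \<noteq> 0\<close>. Tracking the variables that occur allows changing the irrelevant
  coordinates.\<close>

definition laurent_in :: "nat set \<Rightarrow> laurent set" where
  "laurent_in S = {p. \<forall>m\<in>Poly_Mapping.keys p. Poly_Mapping.keys m \<subseteq> S}"

lemma laurent_eval_cong:
  assumes "p \<in> laurent_in S" "\<And>i. i \<in> S \<Longrightarrow> x i = y i"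
  shows "laurent_eval x p = laurent_eval y p"
  unfolding laurent_eval_def using assms
  by (intro sum.cong prod.cong arg_cong2[where f = "(*)"] refl) (auto simp: laurent_in_def subset_iff)

lemma laurent_in_0: "0 \<in> laurent_in S"
  and laurent_in_1: "1 \<in> laurent_in S"
  and laurent_in_uminus: "p \<in> laurent_in S \<Longrightarrow> - p \<in> laurent_in S"
  by (simp_all add: laurent_in_def)

lemma laurent_in_add: "p \<in> laurent_in S \<Longrightarrow> r \<in> laurent_in S \<Longrightarrow> p + r \<in> laurent_in S"
  unfolding laurent_in_def using keys_add[of p r] by blast

lemma laurent_in_diff: "p \<in> laurent_in S \<Longrightarrow> r \<in> laurent_in S \<Longrightarrow> p - r \<in> laurent_in S"
  using laurent_in_add[of p S "- r"] laurent_in_uminus[of r S] by simp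

lemma laurent_in_mult: "p \<in> laurent_in S \<Longrightarrow> r \<in> laurent_in S \<Longrightarrow> p * r \<in> laurent_in S"
  unfolding laurent_in_def
  by (auto dest!: subsetD[OF keys_mult] subsetD[OF keys_add])

lemma laurent_in_var_pow: "i \<in> S \<Longrightarrow> var_pow i n \<in> laurent_in S"
  by (cases "n = 0") (auto simp: laurent_in_def var_pow_def)

lemma laurent_in_power: "p \<in> laurent_in S \<Longrightarrow> p ^ n \<in> laurent_in S"
  by (induction n) (auto intro: laurent_in_1 laurent_in_mult)

lemma laurent_in_of_nat: "of_nat n \<in> laurent_in S"
  by (induction n) (auto intro: laurent_in_0 laurent_in_1 laurent_in_add)

lemma laurent_in_sum: "(\<And>i. i \<in> A \<Longrightarrow> f i \<in> laurent_in S) \<Longrightarrow> sum f A \<in> laurent_in S"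
  by (induction A rule: infinite_finite_induct) (auto intro: laurent_in_0 laurent_in_add)

lemma laurent_in_prod: "(\<And>i. i \<in> A \<Longrightarrow> f i \<in> laurent_in S) \<Longrightarrow> prod f A \<in> laurent_in S"
  by (induction A rule: infinite_finite_induct) (auto intro: laurent_in_1 laurent_in_mult)

lemma laurent_in_det:
  assumes "\<And>i j. i < n \<Longrightarrow> j < n \<Longrightarrow> f i j \<in> laurent_in S"
  shows "det (mat n n (\<lambda>(i,j). f i j)) \<in> laurent_in S"
proof -
  have "signof p \<in> laurent_in S" for p
    by (cases p rule: sign_cases) (simp_all add: laurent_in_1 laurent_in_uminus)
  moreover have "(\<Prod>i=0..<n. mat n n (\<lambda>(i,j). f i j) $$ (i, p i)) \<in> laurent_in S"
    if "p permutes {0..<n}" for p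
  proof (rule laurent_in_prod)
    fix i assume "i \<in> {0..<n}"
    then show "mat n n (\<lambda>(i,j). f i j) $$ (i, p i) \<in> laurent_in S"
      using assms[of i "p i"] permutes_in_image[OF that, of i] by simp
  qed
  ultimately show ?thesis
    unfolding det_def by (auto intro!: laurent_in_sum laurent_in_mult)
qed

lemma laurent_in_newton:
  assumes "\<And>i. i \<le> k \<Longrightarrow> t i \<in> laurent_in S"
  shows "newton t k m \<in> laurent_in S"
  using assms
  by (induction t k m rule: newton.induct)
    (auto intro!: laurent_in_0 laurent_in_1 laurent_in_add laurent_in_diff laurent_in_mult)

section \<open>Symplectic characters\<close>

abbreviation symp_node :: "nat \<Rightarrow> laurent" where
  "symp_node i \<equiv> var_pow (Suc i) 1 + var_pow (Suc i) (-1)"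

definition newton_det :: "nat \<Rightarrow> (nat \<Rightarrow> nat) \<Rightarrow> laurent" where
  "newton_det L mu = det (mat L L (\<lambda>(i,j). newton symp_node i (mu (Suc j))))"

lemma delta_Suc: "j < L \<Longrightarrow> delta L (Suc j) = L - j"
  by (simp add: delta_def)

lemma newton_det_delta: "newton_det L (delta L) = (-1) ^ (L * (L - 1) div 2)"
proof -
  have "mat L L (\<lambda>(i,j). newton symp_node i (delta L (Suc j))) = mat L L (\<lambda>(i,j). newton symp_node i (L - j))"
    by (intro cong_mat) (auto simp: delta_Suc)
  then show ?thesis by (simp add: newton_det_def det_newton_delta)
qed

text \<open>One \<open>V\<close> serves all \<open>mu\<close>, so it cancels in the quotient that
  defines the character.\<close>

lemma alt_factor: "\<exists>V. \<forall>mu. alt L mu = V * newton_det L mu"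
proof -
  have "var_pow i (int m) - var_pow i (- int m) = var_pow i 1 ^ m - var_pow i (-1) ^ m" for i m
    using var_pow_mult[of i 1 m] var_pow_mult[of i "-1" m] by simp
  moreover have "var_pow i 1 * var_pow i (-1) = 1" for i
    using var_pow_add[of i 1 "-1"] by (simp add: var_pow_0)
  ultimately show ?thesis
    unfolding alt_def newton_det_def
    using det_power_diff[of L "\<lambda>i. var_pow (Suc i) 1" "\<lambda>i. var_pow (Suc i) (-1)"]
    by (simp only:) blast
qed

lemma newton_det_mult_alt:
  "(-1) ^ (L * (L - 1) div 2) * newton_det L mu * alt L (delta L) = alt L mu"
proof -
  obtain V where V: "\<And>mu. alt L mu = V * newton_det L mu" using alt_factor by blast
  let ?e = "(-1) ^ (L * (L - 1) div 2) :: laurent"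
  have "?e * newton_det L mu * (V * ?e) = ?e * (?e * (V * newton_det L mu))"
    by (simp only: mult_ac)
  then show ?thesis
    by (simp only: V newton_det_delta minus_one_power_square)
qed

text \<open>Cancelling the nonzero \<open>alt L (delta L)\<close> makes the quotient unique, so the
  definite description denotes it.\<close>

lemma symp_char_eq:
  assumes "alt L (delta L) \<noteq> 0"
  shows "symp_char L lam = (-1) ^ (L * (L - 1) div 2) * newton_det L (\<lambda>i. lam i + delta L i)"
  unfolding symp_char_def
proof (rule the_equality)
  fix c assume "c * alt L (delta L) = alt L (\<lambda>i. lam i + delta L i)"
  then have "c * alt L (delta L) = (-1) ^ (L * (L - 1) div 2) * newton_det L (\<lambda>i. lam i + delta L i) * alt L (delta L)"
    by (simp only: newton_det_mult_alt)
  then show "c = (-1) ^ (L * (L - 1) div 2) * newton_det L (\<lambda>i. lam i + delta L i)"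
    by (simp only: mult_right_cancel[OF assms])
qed (rule newton_det_mult_alt)

lemma symp_char_mult_alt:
  assumes "alt L (delta L) \<noteq> 0"
  shows "symp_char L lam * alt L (delta L) = alt L (\<lambda>i. lam i + delta L i)"
  unfolding symp_char_eq[OF assms] by (rule newton_det_mult_alt)

lemma symp_char_in:
  assumes "alt L (delta L) \<noteq> 0"
  shows "symp_char L lam \<in> laurent_in {1..L}"
proof -
  have "(-1 :: laurent) ^ k \<in> laurent_in {1..L}" for k
    by (induction k) (auto intro: laurent_in_1 laurent_in_uminus)
  then show ?thesis
    unfolding symp_char_eq[OF assms] newton_det_def
    by (intro laurent_in_mult laurent_in_det laurent_in_newton laurent_in_add laurent_in_var_pow) auto
qed

text \<open>This formula does not divide by the value of \<open>alt L (delta L)\<close> at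
  \<open>x\<close>, so it holds also where that value is 0, as at (1,...,1) .\<close>

lemma laurent_eval_symp_char:
  assumes "alt L (delta L) \<noteq> 0" "\<And>i. x i \<noteq> 0"
  shows "laurent_eval x (symp_char L lam) = (-1) ^ (L * (L - 1) div 2) *
    det (mat L L (\<lambda>(i,j). newton (\<lambda>i. x (Suc i) + inverse (x (Suc i))) i (lam (Suc j) + delta L (Suc j))))"
proof -
  interpret comm_ring_hom "laurent_eval x" by (rule comm_ring_hom_laurent_eval) (rule assms)
  have "laurent_eval x (newton_det L mu) =
     det (mat L L (\<lambda>(i,j). newton (\<lambda>i. x (Suc i) + inverse (x (Suc i))) i (mu (Suc j))))" for mu
    unfolding newton_det_def hom_det[symmetric]
    by (intro arg_cong[where f = det] eq_matI)
      (auto simp: hom_newton hom_add laurent_eval_var_pow power_int_minus)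
  then show ?thesis
    by (simp add: symp_char_eq[OF assms(1)] hom_mult hom_power hom_uminus)
qed

lemma laurent_eval_alt_part:
  assumes "\<And>i. x i \<noteq> 0"
  shows "laurent_eval x (alt_part k L mu) = det (mat L L (\<lambda>(i, j).
     if Suc i < k then x (Suc i) ^ mu (Suc j) - inverse (x (Suc i)) ^ mu (Suc j)
     else of_nat (mu (Suc j)) ^ (2 * (L - Suc i) + 1)))"
proof -
  interpret comm_ring_hom "laurent_eval x" by (rule comm_ring_hom_laurent_eval) (rule assms)
  show ?thesis
    unfolding alt_part_def hom_det[symmetric]
    by (intro arg_cong[where f = det] eq_matI)
      (auto simp: hom_minus hom_mult hom_power hom_of_nat laurent_eval_var_pow power_int_minus power_inverse)
qed

lemma alt_part_max: "alt_part (L + 1) L mu = alt L mu"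
  unfolding alt_part_def alt_def by (intro arg_cong[where f = det] cong_mat) auto

text \<open>All rows lie in the span of the divided differences at the nodes of \<open>x\<close>, so
  \<open>det_newton_span\<close> applies. The case \<open>k = 1\<close> concerns the point
  (1,...,1), the case \<open>k = 2\<close> the point (z,1,...,1).\<close>

lemma laurent_eval_alt_part_spec:
  assumes "alt L (delta L) \<noteq> 0" "\<And>i. x i \<noteq> 0" "\<And>i. i \<ge> k \<Longrightarrow> x i = 1" "k = 1 \<or> k = 2"
  shows "laurent_eval x (alt_part k L (\<lambda>i. lam i + delta L i)) =
     laurent_eval x (symp_char L lam) * laurent_eval x (alt_part k L (delta L))"
proof -
  define r where "r i m = (if Suc i < k then x (Suc i) ^ m - inverse (x (Suc i)) ^ m
     else of_nat m ^ (2 * (L - Suc i) + 1))" for i m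
  define t where "t i = x (Suc i) + inverse (x (Suc i))" for i
  have t2: "t i = 2" if "Suc i \<ge> k" for i using assms(3)[OF that] by (simp add: t_def)
  have span: "r i \<in> newton_span t L" if "i < L" for i
  proof (cases "Suc i < k")
    case True
    then have "i = 0" "k = 2" using assms(4) by auto
    have "r 0 m = (x 1 - inverse (x 1)) * newton t 0 m" for m
      using power_diff_eq_newton[of "x 1" "inverse (x 1)" m] newton_node[of t m] assms(2)[of 1] \<open>k = 2\<close>
      by (simp add: r_def t_def)
    then have "r 0 = (\<lambda>m. (x 1 - inverse (x 1)) * newton t 0 m)" by blast
    then show ?thesis
      using that \<open>i = 0\<close> by (simp add: newton_span_mult newton_span_newton)
  next
    case False
    then have r: "r i = (\<lambda>m. of_nat m ^ (2 * (L - Suc i) + 1))" by (simp add: r_def fun_eq_iff)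
    show ?thesis
    proof (cases "k = 1")
      case True
      then have "t = (\<lambda>_. 2)" using t2 by auto
      then show ?thesis unfolding r using odd_power_newton_span[of "L - Suc i" L] that by simp
    next
      case False
      then show ?thesis unfolding r using assms(4) \<open>\<not> Suc i < k\<close> that t2
        by (intro odd_power_newton_span_shift) auto
    qed
  qed
  have *: "laurent_eval x (alt_part k L mu) = det (mat L L (\<lambda>(i,j). r i (mu (Suc j))))" for mu
    unfolding laurent_eval_alt_part[OF assms(2)] r_def by simp
  have d: "mat L L (\<lambda>(i,j). r i (delta L (Suc j))) = mat L L (\<lambda>(i,j). r i (L - j))"
    by (intro cong_mat) (auto simp: delta_Suc)
  show ?thesis
    unfolding * d laurent_eval_symp_char[OF assms(1,2)] t_def[symmetric]
    by (rule det_newton_span[OF span])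
qed

section \<open>Determinants of odd powers\<close>

lemma det_odd_powers_nonzero:
  fixes mu :: "nat \<Rightarrow> nat"
  assumes "inj_on mu {1..L}" "\<And>i. i \<in> {1..L} \<Longrightarrow> mu i > 0"
  shows "det (mat L L (\<lambda>(i,j). (of_nat (mu (Suc j)) :: complex) ^ (2 * (L - Suc i) + 1))) \<noteq> 0"
    (is "det ?M \<noteq> 0")
proof
  assume "det ?M = 0"
  then have "det (transpose_mat ?M) = 0" by (simp add: det_transpose[of _ L])
  then obtain v where v: "v \<in> carrier_vec L" "v \<noteq> 0\<^sub>v L" "transpose_mat ?M *\<^sub>v v = 0\<^sub>v L"
    using det_0_iff_vec_prod_zero[of "transpose_mat ?M" L] by auto
  \<comment> \<open>Column \<open>j\<close> of the matrix paired with \<open>v\<close> is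
    \<open>mu (Suc j)\<close> times the value of \<open>p\<close> at its square. Thus
    \<open>p\<close> has degree below \<open>L\<close> and \<open>L\<close> distinct roots.\<close>
  define p where "p = (\<Sum>i<L. monom (v $ i) (L - Suc i))"
  have deg: "degree p < card (mu ` {1..L})" if "L > 0"
  proof -
    have "degree p \<le> L - 1" unfolding p_def
      by (intro degree_sum_le) (auto intro: order.trans[OF degree_monom_le])
    then show ?thesis using that assms(1) by (simp add: card_image)
  qed
  have root: "poly p (of_nat (mu (Suc j)) ^ 2) = 0" if "j < L" for j
  proof -
    have "0 = (transpose_mat ?M *\<^sub>v v) $ j" using v(3) that by simp
    also have "\<dots> = (\<Sum>i<L. of_nat (mu (Suc j)) ^ (2 * (L - Suc i) + 1) * v $ i)"
      using that v(1) by (simp add: scalar_prod_def lessThan_atLeast0)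
    also have "\<dots> = of_nat (mu (Suc j)) * poly p (of_nat (mu (Suc j)) ^ 2)"
      unfolding p_def poly_sum poly_monom sum_distrib_left
      by (intro sum.cong refl) (simp only: power_add power_mult power_one_right mult_ac)
    finally show ?thesis using assms(2)[of "Suc j"] that by simp
  qed
  have "p = 0"
  proof (cases "L = 0")
    case False
    show ?thesis
    proof (rule poly_eqI_degree[of "(\<lambda>n. (of_nat n :: complex) ^ 2) ` mu ` {1..L}"])
      have "inj_on (\<lambda>n. (of_nat n :: complex) ^ 2) A" for A
        by (auto simp: inj_on_def simp flip: of_nat_power)
      then show "degree p < card ((\<lambda>n. (of_nat n :: complex) ^ 2) ` mu ` {1..L})"
        using deg False by (simp add: card_image)
      then show "degree (0 :: complex poly) < card ((\<lambda>n. (of_nat n :: complex) ^ 2) ` mu ` {1..L})"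
        by simp
    next
      fix x assume "x \<in> (\<lambda>n. (of_nat n :: complex) ^ 2) ` mu ` {1..L}"
      then obtain i where i: "i \<in> {1..L}" "x = of_nat (mu i) ^ 2" by auto
      moreover from i(1) have "i - 1 < L" "Suc (i - 1) = i" by auto
      ultimately show "poly p x = poly 0 x" using root[of "i - 1"] by simp
    qed
  qed (simp add: p_def)
  have "v $ i = 0" if "i < L" for i
  proof -
    have "coeff p (L - Suc i) = (\<Sum>k<L. if k = i then v $ k else 0)"
      unfolding p_def coeff_sum using that by (intro sum.cong) auto
    then show ?thesis using that \<open>p = 0\<close> by simp
  qed
  then have "v = 0\<^sub>v L" using v(1) by (intro eq_vecI) auto
  then show False using v(2) by simp
qed

section \<open>The differential operator\<close>

text \<open>The hypothesis on \<open>h\<close> says that z d/dz sends \<open>h m\<close> to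
  \<open>h (Suc m)\<close>, so \<open>n j\<close> counts the derivations applied to the factor
  \<open>j\<close>. As \<open>g\<close> is known only at nonzero coordinates, the product formula is
  first obtained near \<open>y i\<close>.\<close>

lemma D_eq_on:
  assumes g: "\<And>y. (\<forall>j\<in>{1..L}. y j \<noteq> 0) \<Longrightarrow> g y = (\<Prod>j=1..L. h (n j) (y j))"
    and h: "\<And>m z. z \<noteq> 0 \<Longrightarrow> (h m has_field_derivative h (Suc m) z / z) (at z)"
    and i: "i \<in> {1..L}" and y: "\<forall>j\<in>{1..L}. y j \<noteq> 0"
  shows "D i g y = (\<Prod>j=1..L. h ((n(i := Suc (n i))) j) (y j))"
proof -
  define C where "C = (\<Prod>j\<in>{1..L} - {i}. h (n j) (y j))"
  have *: "(\<Prod>j=1..L. h (n j) ((y(i := t)) j)) = h (n i) t * C" for t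
    unfolding C_def prod.remove[OF finite_atLeastAtMost i, of "\<lambda>j. h (n j) ((y(i := t)) j)"]
    by (auto intro!: prod.cong arg_cong2[where f = "(*)"])
  have "y i \<noteq> 0" using i y by blast
  then have "eventually (\<lambda>t. t \<noteq> 0) (nhds (y i))"
    by (rule t1_space_nhds)
  then have "eventually (\<lambda>t. g (y(i := t)) = h (n i) t * C) (nhds (y i))"
  proof eventually_elim
    case (elim t)
    then show ?case using g[of "y(i := t)"] y * by auto
  qed
  then have "deriv (\<lambda>t. g (y(i := t))) (y i) = deriv (\<lambda>t. h (n i) t * C) (y i)"
    by (intro deriv_cong_ev) auto
  also have "\<dots> = h (Suc (n i)) (y i) / y i * C"
    by (intro DERIV_imp_deriv DERIV_cmult_right h \<open>y i \<noteq> 0\<close>)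
  finally have "D i g y = h (Suc (n i)) (y i) * C"
    using \<open>y i \<noteq> 0\<close> by (simp add: D_def)
  also have "\<dots> = (\<Prod>j=1..L. h ((n(i := Suc (n i))) j) (y j))"
    unfolding C_def prod.remove[OF finite_atLeastAtMost i, of "\<lambda>j. h ((n(i := Suc (n i))) j) (y j)"]
    by (auto intro!: prod.cong arg_cong2[where f = "(*)"])
  finally show ?thesis .
qed

lemma D_power_eq_on:
  assumes g: "\<And>y. (\<forall>j\<in>{1..L}. y j \<noteq> 0) \<Longrightarrow> g y = (\<Prod>j=1..L. h (n j) (y j))"
    and h: "\<And>m z. z \<noteq> 0 \<Longrightarrow> (h m has_field_derivative h (Suc m) z / z) (at z)"
    and i: "i \<in> {1..L}" and y: "\<forall>j\<in>{1..L}. y j \<noteq> 0"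
  shows "(D i ^^ k) g y = (\<Prod>j=1..L. h ((n(i := n i + k)) j) (y j))"
  using y
proof (induction k arbitrary: y)
  case 0
  then show ?case using g by simp
next
  case (Suc k)
  show ?case
    using D_eq_on[where n = "n(i := n i + k)", OF Suc.IH h i Suc.prems] by (simp cong: if_cong)
qed

text \<open>Distinctness ensures that each variable is still underived, with count 0, when its
  operator is applied.\<close>

lemma foldr_D_eq_on:
  assumes g: "\<And>y. (\<forall>j\<in>{1..L}. y j \<noteq> 0) \<Longrightarrow> g y = (\<Prod>j=1..L. h 0 (y j))"
    and h: "\<And>m z. z \<noteq> 0 \<Longrightarrow> (h m has_field_derivative h (Suc m) z / z) (at z)"
    and "distinct is" "set is \<subseteq> {1..L}" and y: "\<forall>j\<in>{1..L}. y j \<noteq> 0"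
  shows "foldr (\<lambda>i. D i ^^ a i) is g y = (\<Prod>j=1..L. h (if j \<in> set is then a j else 0) (y j))"
  using assms(3-)
proof (induction "is" arbitrary: y)
  case Nil
  then show ?case using g by simp
next
  case (Cons i "is")
  let ?n = "\<lambda>j. if j \<in> set is then a j else 0"
  have IH: "foldr (\<lambda>i. D i ^^ a i) is g z = (\<Prod>j=1..L. h (?n j) (z j))" if "\<forall>j\<in>{1..L}. z j \<noteq> 0" for z
    using Cons.prems that by (intro Cons.IH) auto
  have "foldr (\<lambda>i. D i ^^ a i) (i # is) g y = (D i ^^ a i) (foldr (\<lambda>i. D i ^^ a i) is g) y"
    by simp
  also have "\<dots> = (\<Prod>j=1..L. h ((?n(i := ?n i + a i)) j) (y j))"
    by (rule D_power_eq_on[where h = h and n = ?n, OF IH h]) (use Cons.prems in auto)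
  also have "\<dots> = (\<Prod>j=1..L. h (if j \<in> set (i # is) then a j else 0) (y j))"
    using Cons.prems(1) by (intro prod.cong refl arg_cong2[where f = h]) simp_all
  finally show ?case .
qed

text \<open>On a product of one-variable functions, every Leibniz term of \<open>K\<close> splits
  into factors, which gives an ordinary determinant.\<close>

lemma K_prod:
  assumes g: "\<And>y. (\<forall>j\<in>{1..L}. y j \<noteq> 0) \<Longrightarrow> g y = (\<Prod>j=1..L. h 0 (y j))"
    and h: "\<And>m z. z \<noteq> 0 \<Longrightarrow> (h m has_field_derivative h (Suc m) z / z) (at z)"
    and x: "\<forall>j\<in>{1..L}. x j \<noteq> 0"
  shows "K L g x = det (mat L L (\<lambda>(i,j). h (2 * (L - Suc j)) (x (Suc i))))"
proof -
  have bij: "bij_betw Suc {0..<L} {1..L}"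
    by (simp add: bij_betw_def image_Suc_lessThan flip: lessThan_atLeast0)
  then have bij': "bij_betw (\<lambda>i. i - 1) {1..L} {0..<L}"
    by (intro bij_betw_byWitness[where f' = Suc]) auto
  have "K L g x = (\<Sum>p | p permutes {1..L}. of_int (sign p) * (\<Prod>j=1..L. h (2 * (L - p j)) (x j)))"
    unfolding K_def
  proof (intro sum.cong refl arg_cong2[where f = "(*)"])
    fix p :: "nat \<Rightarrow> nat"
    have "foldr (\<lambda>i. D i ^^ (2 * (L - p i))) [1..<Suc L] g x
        = (\<Prod>j=1..L. h (if j \<in> set [1..<Suc L] then 2 * (L - p j) else 0) (x j))"
      by (rule foldr_D_eq_on[where h = h, OF g h _ _ x]) auto
    also have "\<dots> = (\<Prod>j=1..L. h (2 * (L - p j)) (x j))"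
      by (intro prod.cong refl) auto
    finally show "foldr (\<lambda>i. D i ^^ (2 * (L - p i))) [1..<Suc L] g x
        = (\<Prod>j=1..L. h (2 * (L - p j)) (x j))" .
  qed
  also have "\<dots> = (\<Sum>p | p permutes {0..<L}. of_int (sign p) *
      (\<Prod>j=0..<L. h (2 * (L - Suc (p j))) (x (Suc j))))"
  \<comment> \<open>Conjugation by \<open>Suc\<close> passes between the two index ranges and
    preserves signs.\<close>
  proof (rule sum.reindex_bij_witness[symmetric,
      where i = "map_permutation {1..L} (\<lambda>i. i - 1)" and j = "map_permutation {0..<L} Suc"])
    fix p assume "p \<in> {p. p permutes {0..<L}}"
    then have p: "p permutes {0..<L}" by simp
    show "map_permutation {1..L} (\<lambda>i. i - 1) (map_permutation {0..<L} Suc p) = p"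
      by (rule map_permutation_compose_inv[OF bij p]) auto
    show "map_permutation {0..<L} Suc p \<in> {p. p permutes {1..L}}"
      using map_permutation_permutes[OF bij p] by simp
    have "(\<Prod>j=1..L. h (2 * (L - map_permutation {0..<L} Suc p j)) (x j))
      = (\<Prod>j=0..<L. h (2 * (L - map_permutation {0..<L} Suc p (Suc j))) (x (Suc j)))"
      by (rule prod.reindex_bij_betw[OF bij, symmetric])
    also have "\<dots> = (\<Prod>j=0..<L. h (2 * (L - Suc (p j))) (x (Suc j)))"
      by (intro prod.cong refl) (simp add: map_permutation_apply)
    finally show "of_int (sign (map_permutation {0..<L} Suc p)) *
        (\<Prod>j=1..L. h (2 * (L - map_permutation {0..<L} Suc p j)) (x j))
      = of_int (sign p) * (\<Prod>j=0..<L. h (2 * (L - Suc (p j))) (x (Suc j)))"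
      using p by (simp add: sign_map_permutation)
  next
    fix p assume "p \<in> {p. p permutes {1..L}}"
    then have p: "p permutes {1..L}" by simp
    show "map_permutation {0..<L} Suc (map_permutation {1..L} (\<lambda>i. i - 1) p) = p"
      by (rule map_permutation_compose_inv[OF bij' p]) auto
    show "map_permutation {1..L} (\<lambda>i. i - 1) p \<in> {p. p permutes {0..<L}}"
      using map_permutation_permutes[OF bij' p] by simp
  qed
  also have "\<dots> = det (mat L L (\<lambda>(i,j). h (2 * (L - Suc j)) (x (Suc i))))"
  proof -
    have "mat L L (\<lambda>(i,j). h (2 * (L - Suc j)) (x (Suc i))) $$ (i, p i) = h (2 * (L - Suc (p i))) (x (Suc i))"
      if "p permutes {0..<L}" "i \<in> {0..<L}" for p i
      using that permutes_in_image[OF that(1), of i] by simp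
    then show ?thesis by (simp add: det_def)
  qed
  finally show ?thesis .
qed

section \<open>The one-variable functions \<open>phi\<close> and their image under
  \<open>K\<close>\<close>

lemma alt_part_in: "alt_part k L mu \<in> laurent_in {1..L}"
  unfolding alt_part_def
  by (intro laurent_in_det)
    (simp add: laurent_in_diff laurent_in_var_pow laurent_in_mult laurent_in_power laurent_in_of_nat)

definition odd_power_mat :: "nat \<Rightarrow> (nat \<Rightarrow> nat) \<Rightarrow> complex mat" where
  "odd_power_mat L mu = mat L L (\<lambda>(i,j). of_nat (mu (Suc j)) ^ (2 * (L - Suc i) + 1))"

lemma laurent_eval_alt_part_1:
  assumes "\<And>i. x i \<noteq> 0"
  shows "laurent_eval x (alt_part 1 L mu) = det (odd_power_mat L mu)"
  by (simp add: laurent_eval_alt_part[OF assms] odd_power_mat_def)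

text \<open>Only the first variable occurs in \<open>alt_part 2\<close>, so the constant point z may
  be replaced by (z,1,...,1). The nonzero determinant for \<open>lam + delta\<close> forces both the
  character at (1,...,1) and the determinant for \<open>delta\<close> to be nonzero.\<close>

lemma q_mult_phi:
  assumes "alt L (delta L) \<noteq> 0" "z \<noteq> 0" "det (odd_power_mat L (\<lambda>i. lam i + delta L i)) \<noteq> 0"
  shows "phi L (delta L) 1 (\<lambda>_. z) * q L lam z = phi L (\<lambda>i. lam i + delta L i) 1 (\<lambda>_. z)"
proof -
  let ?x = "\<lambda>i::nat. if i = 1 then z else 1" and ?mu = "\<lambda>i. lam i + delta L i"
  have x: "?x i \<noteq> 0" for i using assms(2) by simp
  have 2: "laurent_eval (\<lambda>_. z) (alt_part 2 L mu) = laurent_eval ?x (alt_part 2 L mu)" for mu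
    unfolding laurent_eval_alt_part[of ?x, OF x] laurent_eval_alt_part[of "\<lambda>_. z", OF assms(2)]
    by (intro arg_cong[where f = det] cong_mat) auto
  have 3: "laurent_eval ?x (alt_part 2 L ?mu) =
      laurent_eval ?x (symp_char L lam) * laurent_eval ?x (alt_part 2 L (delta L))"
    by (rule laurent_eval_alt_part_spec[OF assms(1) x]) auto
  have 4: "det (odd_power_mat L ?mu) =
      laurent_eval (\<lambda>_. 1) (symp_char L lam) * det (odd_power_mat L (delta L))"
    using laurent_eval_alt_part_spec[OF assms(1), of "\<lambda>_. 1" 1 lam]
    by (simp add: laurent_eval_alt_part_1 del: One_nat_def)
  show ?thesis
    using assms(3)
    by (simp add: phi_def q_def 2 3 4 laurent_eval_alt_part_1[of "\<lambda>_. z", OF assms(2)]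
        numeral_2_eq_2[symmetric] mult.commute del: One_nat_def)
qed

text \<open>The first column of the inverse of \<open>odd_power_mat L mu\<close>, written with
  cofactors.\<close>

definition phi_coeff :: "nat \<Rightarrow> (nat \<Rightarrow> nat) \<Rightarrow> nat \<Rightarrow> complex" where
  "phi_coeff L mu j = cofactor (odd_power_mat L mu) 0 j / det (odd_power_mat L mu)"

text \<open>The numerator matrix differs from \<open>odd_power_mat L mu\<close> only in row 0;
  expand along it.\<close>

lemma phi_1_eq:
  assumes "z \<noteq> 0" "L \<ge> 1"
  shows "phi L mu 1 (\<lambda>_. z) =
    (\<Sum>j<L. phi_coeff L mu j * (z powi int (mu (Suc j)) - z powi - int (mu (Suc j))))"
proof -
  let ?M = "odd_power_mat L mu"
  let ?A = "mat L L (\<lambda>(i, j). if Suc i < 2 then z ^ mu (Suc j) - inverse z ^ mu (Suc j)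
     else of_nat (mu (Suc j)) ^ (2 * (L - Suc i) + 1))"
  have "laurent_eval (\<lambda>_. z) (alt_part 2 L mu) = (\<Sum>j<L. ?A $$ (0,j) * cofactor ?A 0 j)"
    using laurent_eval_alt_part[of "\<lambda>_. z", OF assms(1)] laplace_expansion_row[of ?A L 0] assms(2)
    by simp
  also have "\<dots> = (\<Sum>j<L. (z powi int (mu (Suc j)) - z powi - int (mu (Suc j))) * cofactor ?M 0 j)"
  proof (intro sum.cong refl)
    fix j assume j: "j \<in> {..<L}"
    have "mat_delete ?A 0 j = mat_delete ?M 0 j"
      by (auto intro!: eq_matI simp: mat_delete_def odd_power_mat_def)
    then show "?A $$ (0,j) * cofactor ?A 0 j
        = (z powi int (mu (Suc j)) - z powi - int (mu (Suc j))) * cofactor ?M 0 j"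
      using j assms(2) by (simp add: cofactor_def power_int_minus power_inverse)
  qed
  finally show ?thesis
    by (simp add: phi_def phi_coeff_def laurent_eval_alt_part_1[of "\<lambda>_. z", OF assms(1)]
        numeral_2_eq_2[symmetric] sum_divide_distrib mult.commute del: One_nat_def)
qed

lemma sum_phi_coeff:
  assumes "det (odd_power_mat L mu) \<noteq> 0" "i < L"
  shows "(\<Sum>j<L. phi_coeff L mu j * of_nat (mu (Suc j)) ^ (2 * (L - Suc i) + 1)) = (if i = 0 then 1 else 0)"
proof -
  let ?M = "odd_power_mat L mu"
  have M: "?M \<in> carrier_mat L L" by (simp add: odd_power_mat_def)
  have "(?M * adj_mat ?M) $$ (i,0) = (\<Sum>j<L. of_nat (mu (Suc j)) ^ (2 * (L - Suc i) + 1) * cofactor ?M 0 j)"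
    using assms(2) by (auto simp: adj_mat_def odd_power_mat_def scalar_prod_def lessThan_atLeast0)
  moreover have "(?M * adj_mat ?M) $$ (i,0) = (if i = 0 then det ?M else 0)"
    unfolding adj_mat(2)[OF M] using assms(2) by auto
  ultimately show ?thesis
    using assms(1) by (auto simp: phi_coeff_def sum_divide_distrib[symmetric] mult.commute)
qed

lemma K_prod_phi:
  assumes "det (odd_power_mat L mu) \<noteq> 0" "L \<ge> 1" "\<And>i. i \<in> {1..L} \<Longrightarrow> mu i > 0"
    and g: "\<And>y. (\<forall>j\<in>{1..L}. y j \<noteq> 0) \<Longrightarrow> g y = (\<Prod>j=1..L. phi L mu 1 (\<lambda>_. y j))"
    and x: "\<forall>j\<in>{1..L}. x j \<noteq> 0"
  shows "K L g x = (-1) ^ (L * (L - 1) div 2) / det (odd_power_mat L mu) *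
    det (mat L L (\<lambda>(i,j). x (Suc i) powi int (mu (Suc j)) - x (Suc i) powi - int (mu (Suc j))))"
proof -
  define m where "m k = mu (Suc k)" for k
  define c where "c = phi_coeff L mu"
  \<comment> \<open>The n-th iterate of z d/dz on \<open>phi L mu 1\<close>: each application
    multiplies z^m by m and z^(-m) by -m.\<close>
  define h where "h n z = (\<Sum>k<L. c k * of_nat (m k) ^ n * (z powi int (m k) - (-1) ^ n * z powi - int (m k)))"
    for n and z :: complex
  have deriv: "(h n has_field_derivative h (Suc n) z / z) (at z)" if "z \<noteq> 0" for n z
  proof -
    have "(h n has_field_derivative (\<Sum>k<L. c k * of_nat (m k) ^ n *
        (of_int (int (m k)) * z powi (int (m k) - 1) * 1
          - (-1) ^ n * (of_int (- int (m k)) * z powi (- int (m k) - 1) * 1)))) (at z)"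
      unfolding h_def using that
      by (intro DERIV_sum DERIV_cmult DERIV_diff DERIV_power_int DERIV_ident) auto
    also have "(\<Sum>k<L. c k * of_nat (m k) ^ n *
        (of_int (int (m k)) * z powi (int (m k) - 1) * 1
          - (-1) ^ n * (of_int (- int (m k)) * z powi (- int (m k) - 1) * 1))) = h (Suc n) z / z"
      unfolding h_def sum_divide_distrib
      using that by (intro sum.cong refl) (simp add: power_int_diff field_simps)
    finally show ?thesis .
  qed
  have "K L g x = det (mat L L (\<lambda>(i,j). h (2 * (L - Suc j)) (x (Suc i))))"
  proof (rule K_prod[where h = h, OF _ deriv x])
    fix y :: "nat \<Rightarrow> complex" assume y: "\<forall>j\<in>{1..L}. y j \<noteq> 0"
    show "g y = (\<Prod>j=1..L. h 0 (y j))"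
      unfolding g[OF y]
    proof (intro prod.cong refl)
      fix j assume "j \<in> {1..L}"
      then have "y j \<noteq> 0" using y by blast
      show "phi L mu 1 (\<lambda>_. y j) = h 0 (y j)"
        unfolding phi_1_eq[OF \<open>y j \<noteq> 0\<close> assms(2)] by (simp add: h_def c_def m_def)
    qed
  qed
  \<comment> \<open>The orders are even, so the signs \<open>(-1) ^ n\<close> disappear and sines
    and coefficients separate into a matrix product.\<close>
  also have "\<dots> = det (mat L L (\<lambda>(i,j). \<Sum>k<L. (x (Suc i) powi int (m k) - x (Suc i) powi - int (m k)) *
      (c k * of_nat (m k) ^ (2 * (L - Suc j)))))"
    by (simp add: h_def mult.commute)
  also have "\<dots> = det (mat L L (\<lambda>(i,j). x (Suc i) powi int (m j) - x (Suc i) powi - int (m j))) *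
      det (mat L L (\<lambda>(i,j). c i * of_nat (m i) ^ (2 * (L - Suc j))))"
    by (rule det_mat_mult)
  finally have K_eq: "K L g x =
      det (mat L L (\<lambda>(i,j). x (Suc i) powi int (m j) - x (Suc i) powi - int (m j))) *
      det (mat L L (\<lambda>(i,j). c i * of_nat (m i) ^ (2 * (L - Suc j))))" .
  have "det (odd_power_mat L mu) * det (mat L L (\<lambda>(i,j). c i * of_nat (m i) ^ (2 * (L - Suc j))))
      = det (mat L L (\<lambda>(i,j). \<Sum>k<L. of_nat (m k) ^ (2 * (L - Suc i) + 1) *
          (c k * of_nat (m k) ^ (2 * (L - Suc j)))))"
    unfolding odd_power_mat_def m_def by (rule det_mat_mult[symmetric])
  also have "\<dots> = (-1) ^ (L * (L - 1) div 2)"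
  proof (rule det_antitriangular)
    have *: "(\<Sum>k<L. of_nat (m k) ^ (2 * (L - Suc i) + 1) * (c k * of_nat (m k) ^ (2 * (L - Suc j))))
        = (if i + j + 1 = L then 1 else 0)" if "i < L" "j < L" "L \<le> i + j + 1" for i j
    proof -
      \<comment> \<open>Row \<open>l\<close> of \<open>odd_power_mat L mu\<close> carries the
        combined exponent; the subtraction is exact because
        \<open>L \<le> i + j + 1\<close>.\<close>
      define l where "l = i + j + 1 - L"
      have l: "2 * (L - Suc i) + 1 + 2 * (L - Suc j) = 2 * (L - Suc l) + 1" "l < L"
        "l = 0 \<longleftrightarrow> i + j + 1 = L"
        using that by (auto simp: l_def)
      have "(\<Sum>k<L. of_nat (m k) ^ (2 * (L - Suc i) + 1) * (c k * of_nat (m k) ^ (2 * (L - Suc j))))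
        = (\<Sum>k<L. c k * of_nat (m k) ^ (2 * (L - Suc l) + 1))"
        unfolding l(1)[symmetric] power_add[of _ "_ + 1"] by (simp only: mult_ac)
      then show ?thesis
        using sum_phi_coeff[OF assms(1) l(2)] l(3) by (simp add: c_def m_def)
    qed
    show "(\<Sum>k<L. of_nat (m k) ^ (2 * (L - Suc i) + 1) * (c k * of_nat (m k) ^ (2 * (L - Suc j)))) = 0"
      if "i < L" "j < L" "L \<le> i + j" for i j
      using *[of i j] that by simp
    show "(\<Sum>k<L. of_nat (m k) ^ (2 * (L - Suc i) + 1) * (c k * of_nat (m k) ^ (2 * (L - Suc j)))) = 1"
      if "i + j + 1 = L" for i j
      using *[of i j] that by simp
  qed
  finally have "det (odd_power_mat L mu) * det (mat L L (\<lambda>(i,j). c i * of_nat (m i) ^ (2 * (L - Suc j))))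
      = (-1) ^ (L * (L - 1) div 2)" .
  then have "det (mat L L (\<lambda>(i,j). c i * of_nat (m i) ^ (2 * (L - Suc j))))
      = (-1) ^ (L * (L - 1) div 2) / det (odd_power_mat L mu)"
    by (intro eq_divide_imp[OF assms(1)]) (simp only: mult.commute)
  then show ?thesis
    by (simp only: K_eq m_def mult.commute)
qed

theorem proposition4p5p1:
  fixes L :: nat and lam :: "nat \<Rightarrow> nat" and x :: "nat \<Rightarrow> complex"
  assumes "L \<ge> 1"
    and "is_partition L lam"
    and "\<forall>i\<in>{1..L}. x i \<noteq> 0"
    and "phi L (delta L) L x \<noteq> 0"
  shows "S_inv L (\<lambda>y. \<Prod>i=1..L. q L lam (y i)) x =
    laurent_eval x (symp_char L lam) / laurent_eval (\<lambda>_. 1) (symp_char L lam)"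
proof -
  define mu where "mu i = lam i + delta L i" for i
  \<comment> \<open>Setting the irrelevant coordinates to 1 makes evaluation a ring
    homomorphism.\<close>
  define x' where "x' i = (if i \<in> {1..L} then x i else 1)" for i
  let ?A = "det (odd_power_mat L (delta L))" and ?B = "det (odd_power_mat L mu)"
  let ?e = "(-1) ^ (L * (L - 1) div 2) :: complex"
  have x': "x' i \<noteq> 0" for i using assms(3) by (simp add: x'_def)
  interpret comm_ring_hom "laurent_eval x'" by (rule comm_ring_hom_laurent_eval) (rule x')
  have eval_x: "laurent_eval x p = laurent_eval x' p" if "p \<in> laurent_in {1..L}" for p
    using that by (rule laurent_eval_cong) (simp add: x'_def)
  have phi_x: "phi L (delta L) L x = laurent_eval x' (alt L (delta L)) / ?A"
    unfolding phi_def eval_x[OF alt_part_in]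
    unfolding alt_part_max laurent_eval_alt_part_1[of x', OF x'] ..
  \<comment> \<open>A quotient with denominator 0 is 0, so the assumption gives both facts.\<close>
  then have evalnz: "laurent_eval x' (alt L (delta L)) \<noteq> 0" and A: "?A \<noteq> 0"
    using assms(4) by auto
  then have nz: "alt L (delta L) \<noteq> 0" by auto
  have mu_less: "mu j < mu i" if "i \<in> {1..L}" "j \<in> {1..L}" "i < j" for i j
  proof -
    have "lam j \<le> lam i" using assms(2) that by (auto simp: is_partition_def)
    then show ?thesis using that by (auto simp: mu_def delta_def)
  qed
  then have inj: "inj_on mu {1..L}"
    by (metis inj_onI linorder_neqE_nat less_irrefl)
  have mu_pos: "mu i > 0" if "i \<in> {1..L}" for i by (simp add: mu_def delta_def)
  have B: "?B \<noteq> 0"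
    unfolding odd_power_mat_def by (rule det_odd_powers_nonzero[OF inj mu_pos])
  have "K L (\<lambda>y. (\<Prod>i=1..L. phi L (delta L) 1 (\<lambda>_. y i)) * (\<Prod>i=1..L. q L lam (y i))) x
     = ?e / ?B * det (mat L L (\<lambda>(i,j). x (Suc i) powi int (mu (Suc j)) - x (Suc i) powi - int (mu (Suc j))))"
  proof (rule K_prod_phi[OF B assms(1) mu_pos _ assms(3)])
    fix y :: "nat \<Rightarrow> complex" assume "\<forall>j\<in>{1..L}. y j \<noteq> 0"
    then show "(\<Prod>i=1..L. phi L (delta L) 1 (\<lambda>_. y i)) * (\<Prod>i=1..L. q L lam (y i))
        = (\<Prod>i=1..L. phi L mu 1 (\<lambda>_. y i))"
      using q_mult_phi[OF nz, of _ lam] B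
      unfolding prod.distrib[symmetric] mu_def by (intro prod.cong refl) auto
  qed
  also have "mat L L (\<lambda>(i,j). x (Suc i) powi int (mu (Suc j)) - x (Suc i) powi - int (mu (Suc j)))
      = map_mat (laurent_eval x') (mat L L (\<lambda>(i, j).
         var_pow (Suc i) (int (mu (Suc j))) - var_pow (Suc i) (- int (mu (Suc j)))))"
    by (auto intro!: eq_matI simp: hom_minus laurent_eval_var_pow x'_def)
  also have "det \<dots> = laurent_eval x' (alt L mu)"
    by (simp only: hom_det alt_def)
  also have "alt L mu = symp_char L lam * alt L (delta L)"
    using symp_char_mult_alt[OF nz] by (simp add: mu_def[abs_def])
  finally have K: "K L (\<lambda>y. (\<Prod>i=1..L. phi L (delta L) 1 (\<lambda>_. y i)) * (\<Prod>i=1..L. q L lam (y i))) x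
     = ?e / ?B * (laurent_eval x' (symp_char L lam) * laurent_eval x' (alt L (delta L)))"
    by (simp only: hom_mult)
  have cancel: "e * inverse (v / a) * (e / (c * a) * (w * v)) = w / c"
    if "a \<noteq> 0" "v \<noteq> 0" "e * e = 1" for a c e v w :: complex
  proof -
    have "e * inverse (v / a) * (e / (c * a) * (w * v)) = (e * e) * (w / c)"
      using that(1,2) by (simp add: divide_simps)
    then show ?thesis using that(3) by simp
  qed
  have e: "?e * ?e = 1"
    using minus_one_power_square[of "L * (L - 1) div 2" "1::complex"] by (simp only: mult_1_right)
  \<comment> \<open>The character at (1,...,1) as the ratio of the two odd-power determinants, to
    cancel against \<open>phi_x\<close>.\<close>
  have B_eq: "?B = laurent_eval (\<lambda>_. 1) (symp_char L lam) * ?A"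
    using laurent_eval_alt_part_spec[OF nz, of "\<lambda>_. 1" 1 lam]
    by (simp add: laurent_eval_alt_part_1 mu_def[abs_def] del: One_nat_def)
  show ?thesis
    unfolding S_inv_def K phi_x eval_x[OF symp_char_in[OF nz]] B_eq
    by (rule cancel[OF A evalnz e])
qed

end
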